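(* Assume that $\Phi$ is a homogeneous Poisson point process on $\mathbb{R}^2$ with finite positive intensity $\lambda$, that the fading variable $F$ is exponentially distributed with mean $1/\mu$, that the noise variable $W$ is bounded away from $0$, i.e. $\mathbf{P}\{W>w\}=1$ for some constant $w>0$, and that the path-loss function is $l(r)=(Ar)^\beta$ with $A>0$ and $\beta>2$. Then $$\lim_{|X-Y|\to\infty}\frac{\mathbf{E}^{X,Y}[P_{X,Y}(0)]}{|X-Y|}=\infty ,$$ where $X,Y\in\mathbb{R}^2$ and $P_{X,Y}(0)$ is the delay from $X$ to $Y$ at time $0$ in the space-time SINR graph.
   Context: Model. The points of a point configuration $\Phi=\{X_i\}$ in $\mathbb{R}^2$ (the network nodes) carry random marks: medium access indicators $e_i(n)$, $n\in\mathbb{Z}$, i.i.d. in $i$ and $n$, Bernoulli with $\mathbf{P}\{e=1\}=p=1-\mathbf{P}\{e=0\}$, $0<p<1$; noise powers $W_i(n)\ge 0$, i.i.d. in $i,n$, distributed as $W$; fadings $F_{i,j}(n)\ge 0$, i.i.d. in $i,j,n$, distributed as $F$. Given $\Phi$, the three families are independent, with these laws. $l$ is the path-loss function and $T>0$ is a fixed threshold. Let $I_{i,j}(n)=\sum_{k\ne i:\,e_k(n)=1}F_{k,j}(n)/l(|X_k-X_j|)$ and, when $e_i(n)=1$, $e_j(n)=0$, $\mathrm{SINR}_{i,j}(n)=\dfrac{F_{i,j}(n)/l(|X_i-X_j|)}{W_j(n)+I_{i,j}(n)}$. Put $\delta_{i,j}(n)=\mathbf{1}(\mathrm{SINR}_{i,j}(n)\ge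 T)$ if $i\ne j$, $e_i(n)=1$, $e_j(n)=0$; $\delta_{i,i}(n)=1$; and $\delta_{i,j}(n)=0$ otherwise. The space-time SINR graph $\mathbb{G}$ is the directed graph with vertex set $\Phi\times\mathbb{Z}$ and a directed edge from $(X_i,n)$ to $(X_j,n+1)$ whenever $\delta_{i,j}(n)=1$. The delay $P_{i,j}(n)$ from $X_i$ to $X_j$ at time $n$ is the length (number of edges) of a shortest directed path of $\mathbb{G}$ from $(X_i,n)$ to the set $\{X_j\}\times\mathbb{Z}$. For $X,Y\in\mathbb{R}^2$, $\mathbf{P}^{X,Y}$ (expectation $\mathbf{E}^{X,Y}$) is the two-fold Palm probability of the Poisson process $\Phi$: the point configuration is $\Phi\cup\{X,Y\}$ with $\Phi$ a Poisson process of intensity $\lambda$ under $\mathbf{P}$, and all points of $\Phi\cup\{X,Y\}$ are independently marked, i.e., given the configuration $\Phi\cup\{X,Y\}$, the medium access indicators of its points at all times are i.i.d. Bernoulli with parameter $p$, the noise powers of its points at all times are i.i.d. distributed as $W$, the fadings between its points at all times are i.i.d. distributed as $F$, and these three families are independent. $P_{X,Y}(0)$ denotes the delay from the node $X$ to the node $Y$ at time $0$ under $\mathbf{P}^{X,Y}$. *)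

theory Defs
  imports "HOL-Probability.Probability" "Graph_Theory.Arc_Walk"
begin

section \<open>The space-time SINR graph\<close>

text \<open>
  One realisation of a marked configuration. The nodes are enumerated by the type \<open>'i\<close>;
  \<open>fading N i j n\<close> is the fading on the channel from node \<open>i\<close> to node \<open>j\<close> at time \<open>n\<close>.
\<close>

record 'i network =
  location :: "'i \<Rightarrow> real^2"
  access :: "'i \<Rightarrow> int \<Rightarrow> bool"
  noise :: "'i \<Rightarrow> int \<Rightarrow> real"
  fading :: "'i \<Rightarrow> 'i \<Rightarrow> int \<Rightarrow> real"

definition received_power :: "(real \<Rightarrow> real) \<Rightarrow> 'i network \<Rightarrow> 'i \<Rightarrow> 'i \<Rightarrow> int \<Rightarrow> ennreal" where
  "received_power l N i j n =
     ennreal (fading N i j n) / ennreal (l (dist (location N i) (location N j)))"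

text \<open>
  The interference is an infinite sum of nonnegative terms, so it is taken in \<^typ>\<open>ennreal\<close>:
  a divergent sum is \<open>\<infinity>\<close> and makes the SINR vanish.
\<close>

definition interference :: "(real \<Rightarrow> real) \<Rightarrow> 'i network \<Rightarrow> 'i \<Rightarrow> 'i \<Rightarrow> int \<Rightarrow> ennreal" where
  "interference l N i j n = (\<Sum>\<^sub>\<infinity>k\<in>{k. k \<noteq> i \<and> access N k n}. received_power l N k j n)"

definition SINR :: "(real \<Rightarrow> real) \<Rightarrow> 'i network \<Rightarrow> 'i \<Rightarrow> 'i \<Rightarrow> int \<Rightarrow> ennreal" where
  "SINR l N i j n =
     received_power l N i j n / (ennreal (noise N j n) + interference l N i j n)"

definition successful :: "(real \<Rightarrow> real) \<Rightarrow> real \<Rightarrow> 'i network \<Rightarrow> 'i \<Rightarrow> 'i \<Rightarrow> int \<Rightarrow> bool" where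
  "successful l T N i j n \<longleftrightarrow>
     i = j \<or> (access N i n \<and> \<not> access N j n \<and> SINR l N i j n \<ge> ennreal T)"

type_synonym 'i event = "'i \<times> int"

definition SINR_graph ::
    "(real \<Rightarrow> real) \<Rightarrow> real \<Rightarrow> 'i network \<Rightarrow> ('i event, 'i event \<times> 'i event) pre_digraph" where
  "SINR_graph l T N =
     \<lparr> verts = UNIV,
       arcs = {((i, n), (j, n + 1)) | i j n. successful l T N i j n},
       tail = fst,
       head = snd \<rparr>"

text \<open>The delay is \<open>\<infinity>\<close> if there is no path, being then the infimum of the empty set.\<close>

definition delay :: "(real \<Rightarrow> real) \<Rightarrow> real \<Rightarrow> 'i network \<Rightarrow> 'i \<Rightarrow> 'i \<Rightarrow> int \<Rightarrow> enat" where
  "delay l T N i j n =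
     (INF \<pi> \<in> {\<pi>. \<exists>m. pre_digraph.apath (SINR_graph l T N) (i, n) \<pi> (j, m)}. enat (length \<pi>))"


section \<open>The two-fold Palm model\<close>

text \<open>
  A homogeneous Poisson point process of intensity \<open>lam\<close> on the plane, as a random set.
  Only bounded Borel sets are counted, because \<^const>\<open>card\<close> is 0 on infinite sets.
\<close>

definition poisson_process :: "'w measure \<Rightarrow> real \<Rightarrow> ('w \<Rightarrow> (real^2) set) \<Rightarrow> bool" where
  "poisson_process P lam \<Phi> \<longleftrightarrow>
     (AE \<omega> in P. \<forall>B. bounded B \<longrightarrow> finite (\<Phi> \<omega> \<inter> B)) \<and>
     (\<forall>B \<in> sets borel. bounded B \<longrightarrow>
        (\<lambda>\<omega>. card (\<Phi> \<omega> \<inter> B)) \<in> measurable P (count_space UNIV) \<and>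
        (\<forall>k. measure P {\<omega> \<in> space P. card (\<Phi> \<omega> \<inter> B) = k} =
               (lam * measure lborel B) ^ k / fact k * exp (- (lam * measure lborel B)))) \<and>
     (\<forall>\<B>. \<B> \<subseteq> {B \<in> sets borel. bounded B} \<longrightarrow> disjoint \<B> \<longrightarrow>
        prob_space.indep_vars P (\<lambda>_. count_space UNIV) (\<lambda>B \<omega>. card (\<Phi> \<omega> \<inter> B)) \<B>)"

text \<open>
  The nodes of \<open>\<Phi> \<union> {X, Y}\<close>: the points of \<open>\<Phi>\<close>, almost surely infinitely many, are enumerated
  as \<open>Point 0, Point 1, \<dots>\<close>, and the added points \<open>X\<close> and \<open>Y\<close> are \<open>Source\<close> and \<open>Destination\<close>.
\<close>

datatype node = Source | Destination | Point nat

datatype component =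
  Locations | Access node int | Noise node int | Fading node node int

primrec component_events ::
    "'w measure \<Rightarrow> ('w \<Rightarrow> node network) \<Rightarrow> component \<Rightarrow> 'w set set" where
  "component_events P N Locations =
     {(\<lambda>\<omega>. location (N \<omega>)) -` A \<inter> space P | A. A \<in> sets (Pi\<^sub>M UNIV (\<lambda>_. borel))}"
| "component_events P N (Access i n) =
     {(\<lambda>\<omega>. access (N \<omega>) i n) -` A \<inter> space P | A. A \<in> sets (count_space UNIV)}"
| "component_events P N (Noise i n) =
     {(\<lambda>\<omega>. noise (N \<omega>) i n) -` A \<inter> space P | A. A \<in> sets borel}"
| "component_events P N (Fading i j n) =
     {(\<lambda>\<omega>. fading (N \<omega>) i j n) -` A \<inter> space P | A. A \<in> sets borel}"

text \<open>
  \<open>P\<close> is the two-fold Palm probability at \<open>X\<close>, \<open>Y\<close> and \<open>N\<close> the random marked configuration;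
  \<open>W\<close> and \<open>F\<close> are the laws of the noise and of the fading. That the marks are independent
  with the given laws conditionally on the configuration is expressed by joint independence of
  all marks and the whole family of locations.
\<close>

locale two_point_palm = prob_space P for P :: "'w measure" +
  fixes N :: "'w \<Rightarrow> node network"
    and lam p :: real
    and W F :: "real measure"
    and X Y :: "real^2"
  assumes measurable_location:
      "\<And>i. (\<lambda>\<omega>. location (N \<omega>) i) \<in> measurable P borel"
    and measurable_access:
      "\<And>i n. (\<lambda>\<omega>. access (N \<omega>) i n) \<in> measurable P (count_space UNIV)"
    and measurable_noise:
      "\<And>i n. (\<lambda>\<omega>. noise (N \<omega>) i n) \<in> measurable P borel"
    and measurable_fading:
      "\<And>i j n. (\<lambda>\<omega>. fading (N \<omega>) i j n) \<in> measurable P borel"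
    and location_Source: "AE \<omega> in P. location (N \<omega>) Source = X"
    and location_Destination: "AE \<omega> in P. location (N \<omega>) Destination = Y"
    and inj_Point: "AE \<omega> in P. inj (\<lambda>k. location (N \<omega>) (Point k))"
    and poisson: "poisson_process P lam (\<lambda>\<omega>. range (\<lambda>k. location (N \<omega>) (Point k)))"
    and distr_access:
      "\<And>i n. distr P (count_space UNIV) (\<lambda>\<omega>. access (N \<omega>) i n) = measure_pmf (bernoulli_pmf p)"
    and distr_noise: "\<And>i n. distr P borel (\<lambda>\<omega>. noise (N \<omega>) i n) = W"
    and distr_fading: "\<And>i j n. distr P borel (\<lambda>\<omega>. fading (N \<omega>) i j n) = F"
    and nonneg_noise: "AE v in W. v \<ge> 0"
    and nonneg_fading: "AE v in F. v \<ge> 0"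
    and independent: "indep_sets (component_events P N) UNIV"

end

theory Submission
  imports Defs
begin

text \<open>
  The mean delay is already dominated by the time the message needs to leave its source \<open>X\<close>.
  Write \<open>R = |X - Y|\<close>. With probability \<open>q = exp (- lam * pi * R\<^sup>2)\<close> no point of the Poisson process
  lies within distance \<open>R\<close> of \<open>X\<close>, so every node that could receive from \<open>X\<close>, including \<open>Y\<close>, is at
  distance at least \<open>R\<close>. The noise alone then forces the fading on a successful link of length \<open>r\<close>
  to exceed \<open>T * w * (A * r) powr \<beta>\<close>, which for exponential fading has probability
  \<open>exp (- c * r powr \<beta>)\<close> with \<open>c = \<mu> * T * w * A powr \<beta>\<close>. Since \<open>\<beta> > 2\<close>, this is far smaller than
  \<open>q\<close>: a void of radius \<open>R\<close> is rare, but the waiting time in it is long out of proportion.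

  A union bound, over \<open>Y\<close> and over the points of \<open>\<Phi>\<close> sorted into unit shells around \<open>X\<close>, shows that
  in a given time slot a transmission from \<open>X\<close> to some node at distance at least \<open>R\<close> succeeds with
  probability at most some \<open>\<epsilon>\<close> (lemma \<open>prob_far_success_le\<close>). So the void occurs and
  \<open>m = \<lfloor>q / (2 * \<epsilon>)\<rfloor>\<close> slots pass without such a success with probability at least
  \<open>q - m * \<epsilon> \<ge> q / 2\<close>. Subtracting probabilities instead of conditioning on the void costs
  a second factor \<open>q\<close>, which is harmless because \<open>\<epsilon>\<close> is smaller than any power of \<open>q\<close> for large
  \<open>R\<close>. Hence the mean delay is at least
  \<open>(m + 1) * q / 2 \<ge> q\<^sup>2 / (4 * \<epsilon>)\<close> (lemma \<open>nn_integral_delay_ge\<close>).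

  For every constant \<open>K \<ge> 2\<close> one has \<open>c * r powr \<beta> \<ge> K * r\<^sup>2\<close> at all large \<open>r\<close>, which allows \<open>\<epsilon>\<close> of order
  \<open>exp (- (K - 1) * R\<^sup>2)\<close> (lemma \<open>shell_sum_le\<close>); with \<open>K\<close> large enough, \<open>q\<^sup>2 / (4 * \<epsilon>)\<close> is at
  least of order \<open>exp (R\<^sup>2)\<close>, and divided by \<open>R\<close> it still tends to infinity.
\<close>

section \<open>Escaping from the source\<close>

text \<open>
  The edges that keep the message at \<open>i\<close> exist at all times; they are the only ones leaving a copy of
  \<open>i\<close> at a time when no transmission of \<open>i\<close> succeeds.
\<close>

lemma walk_stays_without_success:
  assumes "pre_digraph.cas (SINR_graph l T N) (i, n) \<pi> v"
    and "set \<pi> \<subseteq> arcs (SINR_graph l T N)"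
    and "\<And>k j. k < length \<pi> \<Longrightarrow> j \<noteq> i \<Longrightarrow> \<not> successful l T N i j (n + int k)"
  shows "fst v = i"
  using assms
proof (induction \<pi> arbitrary: n)
  case Nil
  then show ?case by (auto simp: pre_digraph.cas.simps)
next
  case (Cons e \<pi>)
  obtain j where e: "e = ((i, n), (j, n + 1))" and succ: "successful l T N i j n"
    using Cons.prems(1,2) by (auto simp: pre_digraph.cas.simps SINR_graph_def)
  have "j = i"
    using Cons.prems(3)[of 0 j] succ by auto
  then have "pre_digraph.cas (SINR_graph l T N) (i, n + 1) \<pi> v"
    using Cons.prems(1) e by (simp add: pre_digraph.cas.simps SINR_graph_def)
  moreover have "\<not> successful l T N i j (n + 1 + int k)" if "k < length \<pi>" "j \<noteq> i" for k j
    using Cons.prems(3)[of "Suc k" j] that by (simp add: algebra_simps)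
  ultimately show ?case
    using Cons.IH Cons.prems(2) by simp
qed

lemma delay_ge_if_no_success:
  assumes "i \<noteq> j"
    and "\<And>k j'. k < m \<Longrightarrow> j' \<noteq> i \<Longrightarrow> \<not> successful l T N i j' (n + int k)"
  shows "enat (Suc m) \<le> delay l T N i j n"
  unfolding delay_def
proof (rule INF_greatest)
  fix \<pi> assume "\<pi> \<in> {\<pi>. \<exists>t. pre_digraph.apath (SINR_graph l T N) (i, n) \<pi> (j, t)}"
  then obtain t where walk:
    "pre_digraph.cas (SINR_graph l T N) (i, n) \<pi> (j, t)" "set \<pi> \<subseteq> arcs (SINR_graph l T N)"
    by (auto simp: pre_digraph.apath_def pre_digraph.awalk_def)
  have "\<not> length \<pi> \<le> m"
  proof
    assume "length \<pi> \<le> m"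
    then have "fst (j, t) = i"
      by (intro walk_stays_without_success[OF walk] assms(2)) auto
    then show False
      using \<open>i \<noteq> j\<close> by simp
  qed
  then show "enat (Suc m) \<le> enat (length \<pi>)"
    by simp
qed

lemma inverse_antimono_ennreal: "a \<le> b \<Longrightarrow> inverse b \<le> inverse (a::ennreal)"
  including ennreal.lifting by transfer (rule ereal_inverse_antimono)

text \<open>
  Dropping the interference can only raise the SINR, so a successful transmission must overcome
  the noise by itself.
\<close>

lemma successful_imp_fading_gt:
  assumes succ: "successful l T N i j n" and "i \<noteq> j"
    and "0 < T" and "0 \<le> w" and w: "w < noise N j n"
    and l: "0 < l (dist (location N i) (location N j))"
  shows "T * w * l (dist (location N i) (location N j)) < fading N i j n"
proof -
  define f v r where "f = fading N i j n" and "v = noise N j n"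
    and "r = l (dist (location N i) (location N j))"
  have pos: "0 < v" "0 < r"
    using assms by (auto simp: v_def r_def)
  have "ennreal T \<le> SINR l N i j n"
    using succ \<open>i \<noteq> j\<close> by (simp add: successful_def)
  also have "\<dots> \<le> ennreal f / ennreal r / ennreal v"
    unfolding SINR_def received_power_def f_def v_def r_def
    by (simp add: divide_ennreal_def mult_left_mono inverse_antimono_ennreal)
  finally have le: "ennreal T \<le> ennreal f / ennreal r / ennreal v" .
  then have "0 \<le> f"
    using \<open>0 < T\<close> by (cases "0 \<le> f") (simp_all add: ennreal_neg)
  with le have "T \<le> f / r / v"
    using pos by (simp add: divide_ennreal)
  then have "T * (v * r) \<le> f"
    using pos by (simp add: field_simps)
  moreover have "T * (w * r) < T * (v * r)"
    using pos w \<open>0 < T\<close> by (simp add: v_def)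
  ultimately show ?thesis
    unfolding f_def r_def by (simp add: mult.assoc)
qed

section \<open>The intensity measure of a Poisson process\<close>

lemma poisson_mean_sums:
  "(\<lambda>k. real k * (a ^ k / fact k * exp (- a))) sums (a::real)"
proof -
  have "(\<lambda>k. a ^ k / fact k) sums exp a"
    using exp_converges[of a] by (simp add: scaleR_conv_of_real divide_inverse mult.commute)
  then have "(\<lambda>k. a * exp (- a) * (a ^ k / fact k)) sums (a * exp (- a) * exp a)"
    by (rule sums_mult)
  also have "a * exp (- a) * exp a = a"
    by (simp add: exp_minus)
  also have "(\<lambda>k. a * exp (- a) * (a ^ k / fact k)) =
      (\<lambda>k. real (Suc k) * (a ^ Suc k / fact (Suc k) * exp (- a)))"
    by (simp add: fun_eq_iff field_simps del: of_nat_Suc)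
  finally have "(\<lambda>k. real (Suc k) * (a ^ Suc k / fact (Suc k) * exp (- a))) sums a" .
  then show ?thesis
    by (subst (asm) sums_Suc_iff) simp
qed

instance node :: countable
  by countable_datatype

context two_point_palm
begin

lemmas [measurable] = measurable_location measurable_fading

text \<open>
  Both sides are the mean number of points in \<open>B\<close>. The points are almost surely pairwise distinct, so
  counting the indices \<open>k\<close> with a location in \<open>B\<close> counts the elements of the random set in \<open>B\<close>.
\<close>

lemma sum_prob_location_in:
  assumes [measurable]: "B \<in> sets borel" and "bounded B" and "0 \<le> lam"
  shows "(\<Sum>k. emeasure P {\<omega> \<in> space P. location (N \<omega>) (Point k) \<in> B}) =
    ennreal (lam * measure lborel B)"
proof -
  define C where "C \<omega> = card (range (\<lambda>k. location (N \<omega>) (Point k)) \<inter> B)" for \<omega>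
  define a where "a = lam * measure lborel B"
  have a: "0 \<le> a"
    using \<open>0 \<le> lam\<close> by (simp add: a_def)
  have C[measurable]: "C \<in> measurable P (count_space UNIV)"
    and law: "measure P {\<omega> \<in> space P. C \<omega> = k} = a ^ k / fact k * exp (- a)" for k
    using poisson assms(1,2) unfolding poisson_process_def C_def a_def by blast+
  have "AE \<omega> in P. \<forall>B. bounded B \<longrightarrow> finite (range (\<lambda>k. location (N \<omega>) (Point k)) \<inter> B)"
    using poisson unfolding poisson_process_def by blast
  with inj_Point have count: "AE \<omega> in P. (\<Sum>k. indicator B (location (N \<omega>) (Point k))) = (of_nat (C \<omega>) :: ennreal)"
  proof eventually_elim
    case (elim \<omega>)
    define K where "K = {k. location (N \<omega>) (Point k) \<in> B}"
    have image: "(\<lambda>k. location (N \<omega>) (Point k)) ` K = range (\<lambda>k. location (N \<omega>) (Point k)) \<inter> B"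
      by (auto simp: K_def)
    have inj: "inj_on (\<lambda>k. location (N \<omega>) (Point k)) K"
      using elim(1) by (rule inj_on_subset) simp
    have "finite K"
      using elim(2) \<open>bounded B\<close> image inj finite_image_iff by metis
    have "(\<Sum>k. indicator B (location (N \<omega>) (Point k))) = (\<Sum>k. indicator K k :: ennreal)"
      by (simp add: K_def indicator_def)
    also have "\<dots> = emeasure (count_space UNIV) K"
      by (simp flip: nn_integral_count_space_nat)
    also have "\<dots> = of_nat (card K)"
      using \<open>finite K\<close> by (simp add: emeasure_count_space)
    also have "card K = C \<omega>"
      unfolding C_def image[symmetric] using inj by (simp add: card_image)
    finally show ?case .
  qed
  have "(\<Sum>k. emeasure P {\<omega> \<in> space P. location (N \<omega>) (Point k) \<in> B}) =
      (\<Sum>k. \<integral>\<^sup>+ \<omega>. indicator B (location (N \<omega>) (Point k)) \<partial>P)"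
    by (intro suminf_cong) (auto simp flip: nn_integral_indicator intro!: nn_integral_cong split: split_indicator)
  also have "\<dots> = (\<integral>\<^sup>+ \<omega>. (\<Sum>k. indicator B (location (N \<omega>) (Point k))) \<partial>P)"
    by (rule nn_integral_suminf[symmetric]) measurable
  also have "\<dots> = (\<integral>\<^sup>+ \<omega>. of_nat (C \<omega>) \<partial>P)"
    using count by (rule nn_integral_cong_AE)
  also have "\<dots> = (\<integral>\<^sup>+ \<omega>. (\<Sum>k. of_nat k * indicator {\<omega> \<in> space P. C \<omega> = k} \<omega>) \<partial>P)"
  proof (rule nn_integral_cong)
    fix \<omega> assume "\<omega> \<in> space P"
    then have "(\<Sum>k. of_nat k * indicator {\<omega> \<in> space P. C \<omega> = k} \<omega> :: ennreal) =
        (\<Sum>k\<in>{C \<omega>}. of_nat k * indicator {\<omega> \<in> space P. C \<omega> = k} \<omega>)"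
      by (intro suminf_finite) auto
    then show "of_nat (C \<omega>) = (\<Sum>k. of_nat k * indicator {\<omega> \<in> space P. C \<omega> = k} \<omega> :: ennreal)"
      using \<open>\<omega> \<in> space P\<close> by simp
  qed
  also have "\<dots> = (\<Sum>k. \<integral>\<^sup>+ \<omega>. of_nat k * indicator {\<omega> \<in> space P. C \<omega> = k} \<omega> \<partial>P)"
    by (rule nn_integral_suminf) measurable
  also have "\<dots> = (\<Sum>k. of_nat k * emeasure P {\<omega> \<in> space P. C \<omega> = k})"
    by (intro suminf_cong nn_integral_cmult_indicator) measurable
  also have "\<dots> = (\<Sum>k. ennreal (real k * (a ^ k / fact k * exp (- a))))"
    using a by (simp add: emeasure_eq_measure law ennreal_mult ennreal_of_nat_eq_real_of_nat
        del: times_divide_eq_right)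
  also have "\<dots> = ennreal a"
    using a by (intro suminf_ennreal_eq poisson_mean_sums) simp
  finally show ?thesis
    by (simp add: a_def)
qed

section \<open>The delay in a void around the source\<close>

lemma prob_void_ball:
  assumes "0 \<le> R"
  shows "prob {\<omega> \<in> space P. card (range (\<lambda>k. location (N \<omega>) (Point k)) \<inter> ball x R) = 0} =
    exp (- (lam * pi * R\<^sup>2))"
proof -
  have "prob {\<omega> \<in> space P. card (range (\<lambda>k. location (N \<omega>) (Point k)) \<inter> ball x R) = 0} =
      (lam * measure lborel (ball x R)) ^ 0 / fact 0 * exp (- (lam * measure lborel (ball x R)))"
    using poisson[unfolded poisson_process_def, THEN conjunct2, THEN conjunct1, THEN bspec, of "ball x R"]
    by simp
  also have "measure lborel (ball x R) = pi * R\<^sup>2"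
    using assms by (simp add: content_ball unit_ball_vol_2 mult.commute)
  finally show ?thesis
    by (simp add: mult.assoc)
qed

lemma prob_location_fading:
  assumes [measurable]: "B \<in> sets borel" "D \<in> sets borel"
  shows "prob {\<omega> \<in> space P. location (N \<omega>) k \<in> B \<and> fading (N \<omega>) i j n \<in> D} =
    prob {\<omega> \<in> space P. location (N \<omega>) k \<in> B} * prob {\<omega> \<in> space P. fading (N \<omega>) i j n \<in> D}"
proof -
  define E where "E c = (if c = Locations then {\<omega> \<in> space P. location (N \<omega>) k \<in> B}
    else {\<omega> \<in> space P. fading (N \<omega>) i j n \<in> D})" for c
  have "{\<omega> \<in> space P. location (N \<omega>) k \<in> B} \<in> component_events P N Locations"
  proof -
    have "{f \<in> space (Pi\<^sub>M UNIV (\<lambda>_. borel)). f k \<in> B} \<in> sets (Pi\<^sub>M UNIV (\<lambda>_. borel))"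
      by measurable
    then show ?thesis
      by (auto simp: space_PiM intro!: exI[of _ "{f. f k \<in> B}"])
  qed
  moreover have "{\<omega> \<in> space P. fading (N \<omega>) i j n \<in> D} \<in> component_events P N (Fading i j n)"
    by (auto intro!: exI[of _ D])
  ultimately have "prob (\<Inter>c\<in>{Locations, Fading i j n}. E c) =
      (\<Prod>c\<in>{Locations, Fading i j n}. prob (E c))"
    by (intro indep_setsD[OF independent]) (auto simp: E_def)
  moreover have "(\<Inter>c\<in>{Locations, Fading i j n}. E c) =
      {\<omega> \<in> space P. location (N \<omega>) k \<in> B \<and> fading (N \<omega>) i j n \<in> D}"
    by (auto simp: E_def)
  ultimately show ?thesis
    by (simp add: E_def)
qed

lemma prob_fading_gt:
  assumes F: "F = density lborel (exponential_density \<mu>)" and "0 < \<mu>" and "0 \<le> a"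
  shows "prob {\<omega> \<in> space P. a < fading (N \<omega>) i j n} = exp (- (\<mu> * a))"
proof -
  have "distributed P lborel (\<lambda>\<omega>. fading (N \<omega>) i j n) (exponential_density \<mu>)"
    unfolding distributed_def using distr_fading[of i j n] \<open>0 < \<mu>\<close>
    by (auto simp: F cong: distr_cong)
  from exponential_distributedD_gt[OF this \<open>0 \<le> a\<close> \<open>0 < \<mu>\<close>] show ?thesis
    by (simp add: mult.commute)
qed

lemma AE_noise_gt:
  assumes "AE v in W. w < v"
  shows "AE \<omega> in P. \<forall>i n. w < noise (N \<omega>) i n"
proof -
  have "AE \<omega> in P. w < noise (N \<omega>) i n" for i n
    by (rule AE_distrD[OF measurable_noise[of i n]]) (use assms in \<open>simp only: distr_noise\<close>)
  then show ?thesis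
    by (simp add: AE_all_countable)
qed

text \<open>
  The union bound over the points of the process, sorted by the unit shell around \<open>x\<close> they lie in: in
  the shell starting at \<open>R + m\<close> the threshold for the fading is at least its value at the inner
  radius, and the mean number of points is at most that of the ball of radius \<open>R + m + 1\<close>.
\<close>

lemma prob_far_success_le:
  assumes F: "F = density lborel (exponential_density \<mu>)" and "0 < \<mu>" and "0 \<le> lam"
    and mono: "mono_on {0..} l" and l0: "\<And>r. R \<le> r \<Longrightarrow> 0 \<le> l r"
    and [measurable]: "l \<in> borel_measurable borel" and "0 \<le> a" and "0 \<le> R"
  shows "emeasure P {\<omega> \<in> space P. \<exists>k. R \<le> dist x (location (N \<omega>) (Point k)) \<and>
      a * l (dist x (location (N \<omega>) (Point k))) < fading (N \<omega>) i (Point k) n}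
    \<le> (\<Sum>m. ennreal (lam * pi * (R + real m + 1)\<^sup>2 * exp (- (\<mu> * a * l (R + real m)))))"
    (is "emeasure P ?S \<le> _")
proof -
  define B where "B m = ball x (R + real m + 1)" for m
  have [measurable]: "B m \<in> sets borel" for m
    by (simp add: B_def)
  define E where "E m k = {\<omega> \<in> space P. location (N \<omega>) (Point k) \<in> B m \<and>
    fading (N \<omega>) i (Point k) n \<in> {a * l (R + real m) <..}}" for m k
  have [measurable]: "E m k \<in> sets P" for m k
    unfolding E_def by measurable
  have "?S \<subseteq> (\<Union>m k. E m k)"
  proof
    fix \<omega> assume "\<omega> \<in> ?S"
    then obtain k where "\<omega> \<in> space P" and far: "R \<le> dist x (location (N \<omega>) (Point k))"
      and good: "a * l (dist x (location (N \<omega>) (Point k))) < fading (N \<omega>) i (Point k) n"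
      by blast
    define r where "r = dist x (location (N \<omega>) (Point k))"
    define m where "m = nat \<lfloor>r - R\<rfloor>"
    have m: "R + real m \<le> r" "r < R + real m + 1"
      using far unfolding m_def r_def by linarith+
    have "l (R + real m) \<le> l r"
      using m \<open>0 \<le> R\<close> by (intro mono_onD[OF mono]) auto
    then have "a * l (R + real m) \<le> a * l r"
      using \<open>0 \<le> a\<close> by (rule mult_left_mono)
    then have "\<omega> \<in> E m k"
      using \<open>\<omega> \<in> space P\<close> m good by (simp add: E_def B_def r_def)
    then show "\<omega> \<in> (\<Union>m k. E m k)"
      by blast
  qed
  then have "emeasure P ?S \<le> emeasure P (\<Union>m k. E m k)"
    by (intro emeasure_mono) measurable
  also have "\<dots> \<le> (\<Sum>m. emeasure P (\<Union>k. E m k))"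
    by (rule emeasure_subadditive_countably) auto
  also have "\<dots> \<le> (\<Sum>m. \<Sum>k. emeasure P (E m k))"
    by (intro suminf_le emeasure_subadditive_countably) auto
  also have "\<dots> = (\<Sum>m. ennreal (lam * pi * (R + real m + 1)\<^sup>2 * exp (- (\<mu> * a * l (R + real m)))))"
  proof (rule suminf_cong)
    fix m
    have "emeasure P (E m k) = ennreal (exp (- (\<mu> * a * l (R + real m)))) *
        emeasure P {\<omega> \<in> space P. location (N \<omega>) (Point k) \<in> B m}" for k
      unfolding emeasure_eq_measure E_def prob_location_fading[OF \<open>B m \<in> sets borel\<close> borel_open[OF open_greaterThan]]
      using prob_fading_gt[OF F \<open>0 < \<mu>\<close>, of "a * l (R + real m)" i "Point k" n] \<open>0 \<le> a\<close> \<open>0 \<le> R\<close> l0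
      by (simp add: ennreal_mult mult.commute mult.assoc)
    moreover have "measure lborel (B m) = pi * (R + real m + 1)\<^sup>2"
      using \<open>0 \<le> R\<close> by (simp add: B_def content_ball unit_ball_vol_2 mult.commute)
    ultimately show "(\<Sum>k. emeasure P (E m k)) =
        ennreal (lam * pi * (R + real m + 1)\<^sup>2 * exp (- (\<mu> * a * l (R + real m))))"
      using \<open>0 \<le> lam\<close> sum_prob_location_in[of "B m"]
      by (simp add: B_def ennreal_mult'[symmetric] mult_ac)
  qed
  finally show ?thesis .
qed

text \<open>
  Here \<open>\<epsilon>\<close> bounds the probability that in a given time slot the fading towards \<open>Y\<close> or towards some
  point of the process at least as far away is large enough to overcome the noise. The delay itself
  is not shown to be measurable; it is bounded below by a multiple of the indicator of an event,
  and the integral of that multiple is computed.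
\<close>

lemma nn_integral_delay_ge:
  assumes F: "F = density lborel (exponential_density \<mu>)" and "0 < \<mu>" and "0 \<le> lam"
    and "X \<noteq> Y" and "0 < T" and "0 < w" and W: "AE v in W. w < v"
    and mono: "mono_on {0..} l" and lpos: "\<And>r. 0 < r \<Longrightarrow> 0 < l r"
    and [measurable]: "l \<in> borel_measurable borel" and "0 < \<epsilon>"
    and \<epsilon>: "ennreal (exp (- (\<mu> * (T * w) * l (dist X Y)))) +
      (\<Sum>m. ennreal (lam * pi * (dist X Y + real m + 1)\<^sup>2 * exp (- (\<mu> * (T * w) * l (dist X Y + real m)))))
      \<le> ennreal \<epsilon>"
  shows "ennreal ((exp (- (lam * pi * (dist X Y)\<^sup>2)))\<^sup>2 / (4 * \<epsilon>)) \<le>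
    (\<integral>\<^sup>+ \<omega>. ennreal_of_enat (delay l T (N \<omega>) Source Destination 0) \<partial>P)"
proof -
  define R where "R = dist X Y"
  define q where "q = exp (- (lam * pi * R\<^sup>2))"
  \<comment> \<open>As many slots as cost at most half of the probability \<open>q\<close> of the void \<open>V\<close>.\<close>
  define m where "m = nat \<lfloor>q / (2 * \<epsilon>)\<rfloor>"
  define V where "V = {\<omega> \<in> space P. card (range (\<lambda>k. location (N \<omega>) (Point k)) \<inter> ball X R) = 0}"
  define S where "S n = {\<omega> \<in> space P. \<exists>k. R \<le> dist X (location (N \<omega>) (Point k)) \<and>
    T * w * l (dist X (location (N \<omega>) (Point k))) < fading (N \<omega>) Source (Point k) (int n)}" for n
  define D where "D n = {\<omega> \<in> space P. T * w * l R < fading (N \<omega>) Source Destination (int n)}" for n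
  define G where "G = V - (\<Union>n<m. D n \<union> S n)"
  have R: "0 < R"
    using \<open>X \<noteq> Y\<close> by (simp add: R_def)
  have l0: "0 \<le> l r" if "R \<le> r" for r
    using lpos[of r] R that by simp
  have [measurable]: "S n \<in> sets P" "D n \<in> sets P" for n
    unfolding S_def D_def by measurable
  have V[measurable]: "V \<in> sets P"
  proof -
    have "(\<lambda>\<omega>. card (range (\<lambda>k. location (N \<omega>) (Point k)) \<inter> ball X R)) \<in> measurable P (count_space UNIV)"
      using poisson unfolding poisson_process_def by simp
    then show ?thesis
      unfolding V_def by measurable
  qed
  have q: "0 < q" "prob V = q"
    using R by (simp_all add: q_def V_def prob_void_ball)
  have m: "real m * \<epsilon> \<le> q / 2" "q / (2 * \<epsilon>) \<le> real (Suc m)"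
  proof -
    have "real m \<le> q / (2 * \<epsilon>)"
      unfolding m_def using q \<open>0 < \<epsilon>\<close> by simp
    then show "real m * \<epsilon> \<le> q / 2"
      using \<open>0 < \<epsilon>\<close> by (simp add: field_simps)
    show "q / (2 * \<epsilon>) \<le> real (Suc m)"
      unfolding m_def by linarith
  qed
  have "prob (D n \<union> S n) \<le> \<epsilon>" for n
  proof -
    have "emeasure P (D n \<union> S n) \<le> emeasure P (D n) + emeasure P (S n)"
      by (intro emeasure_subadditive) measurable
    also have "emeasure P (D n) = ennreal (exp (- (\<mu> * (T * w) * l R)))"
      using prob_fading_gt[OF F \<open>0 < \<mu>\<close>, of "T * w * l R" Source Destination "int n"] R \<open>0 < T\<close> \<open>0 < w\<close> l0
      by (simp add: emeasure_eq_measure D_def mult.assoc)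
    also have "emeasure P (S n) \<le>
        (\<Sum>m. ennreal (lam * pi * (R + real m + 1)\<^sup>2 * exp (- (\<mu> * (T * w) * l (R + real m)))))"
      unfolding S_def using R \<open>0 < T\<close> \<open>0 < w\<close> \<open>0 < \<mu>\<close> \<open>0 \<le> lam\<close> l0
      by (intro prob_far_success_le F mono) auto
    also note \<epsilon>[folded R_def]
    finally have "emeasure P (D n \<union> S n) \<le> ennreal \<epsilon>"
      by (simp add: add_left_mono)
    then show ?thesis
      using \<open>0 < \<epsilon>\<close> by (simp add: emeasure_eq_measure)
  qed
  then have "prob (\<Union>n<m. D n \<union> S n) \<le> (\<Sum>n<m. \<epsilon>)"
    by (intro order_trans[OF finite_measure_subadditive_finite] sum_mono) auto
  then have "q / 2 \<le> prob V - prob (\<Union>n<m. D n \<union> S n)"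
    using m(1) q by simp
  also have "\<dots> \<le> prob G"
    unfolding G_def by (rule measure_diff_le_measure_setdiff) (auto simp: fmeasurable_eq_sets)
  finally have G: "q / 2 \<le> prob G" .
  have [measurable]: "G \<in> sets P"
    unfolding G_def by measurable
  have "AE \<omega> in P. \<forall>B. bounded B \<longrightarrow> finite (range (\<lambda>k. location (N \<omega>) (Point k)) \<inter> B)"
    using poisson unfolding poisson_process_def by blast
  then have "AE \<omega> in P. of_nat (Suc m) * indicator G \<omega> \<le>
      ennreal_of_enat (delay l T (N \<omega>) Source Destination 0)"
    using location_Source location_Destination AE_noise_gt[OF W]
  proof eventually_elim
    case (elim \<omega>)
    have "enat (Suc m) \<le> delay l T (N \<omega>) Source Destination 0" if "\<omega> \<in> G"
    proof (rule delay_ge_if_no_success)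
      fix k j assume "k < m" "j \<noteq> Source"
      have "\<omega> \<in> space P" "\<omega> \<in> V" "\<omega> \<notin> D k" "\<omega> \<notin> S k"
        using that \<open>k < m\<close> by (auto simp: G_def V_def)
      have "range (\<lambda>k. location (N \<omega>) (Point k)) \<inter> ball X R = {}"
        using elim(1) \<open>\<omega> \<in> V\<close> by (simp add: V_def)
      then have far: "R \<le> dist X (location (N \<omega>) (Point k))" for k
        by (auto simp: disjoint_iff not_less)
      show "\<not> successful l T (N \<omega>) Source j (0 + int k)"
      proof
        assume succ: "successful l T (N \<omega>) Source j (0 + int k)"
        define d where "d = dist X (location (N \<omega>) j)"
        have "R \<le> d"
          using far elim \<open>j \<noteq> Source\<close> by (cases j) (auto simp: d_def R_def)
        then have "0 < l d"
          using R lpos by simp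
        then have "T * w * l d < fading (N \<omega>) Source j (int k)"
          using successful_imp_fading_gt[OF succ, of w] \<open>j \<noteq> Source\<close> elim \<open>0 < T\<close> \<open>0 < w\<close>
          by (simp add: d_def)
        then have "\<omega> \<in> D k \<union> S k"
          using \<open>j \<noteq> Source\<close> \<open>\<omega> \<in> space P\<close> elim far
          by (cases j) (auto simp: d_def D_def S_def R_def)
        then show False
          using \<open>\<omega> \<notin> D k\<close> \<open>\<omega> \<notin> S k\<close> by simp
      qed
    qed simp
    then have "ennreal_of_enat (enat (Suc m)) \<le> ennreal_of_enat (delay l T (N \<omega>) Source Destination 0)" if "\<omega> \<in> G"
      using that unfolding ennreal_of_enat_le_iff by simp
    then show ?case
      by (cases "\<omega> \<in> G") (simp_all del: ennreal_of_enat_le_iff)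
  qed
  then have "(\<integral>\<^sup>+ \<omega>. of_nat (Suc m) * indicator G \<omega> \<partial>P) \<le>
      (\<integral>\<^sup>+ \<omega>. ennreal_of_enat (delay l T (N \<omega>) Source Destination 0) \<partial>P)"
    by (rule nn_integral_mono_AE)
  moreover have "(\<integral>\<^sup>+ \<omega>. of_nat (Suc m) * indicator G \<omega> \<partial>P) = ennreal (real (Suc m) * prob G)"
    by (subst nn_integral_cmult_indicator)
      (simp_all add: emeasure_eq_measure ennreal_mult ennreal_of_nat_eq_real_of_nat del: of_nat_Suc)
  moreover have "ennreal (q\<^sup>2 / (4 * \<epsilon>)) \<le> ennreal (real (Suc m) * prob G)"
  proof -
    have "q\<^sup>2 / (4 * \<epsilon>) = q / (2 * \<epsilon>) * (q / 2)"
      by (simp add: power2_eq_square)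
    also have "\<dots> \<le> real (Suc m) * prob G"
      using m(2) G q by (intro mult_mono) auto
    finally show ?thesis
      by (rule ennreal_leI)
  qed
  ultimately show ?thesis
    unfolding q_def R_def[symmetric] by (simp only: order_trans)
qed

end

section \<open>Success probabilities against void probabilities\<close>

lemma powr_ge_square:
  assumes "K \<le> c * R powr (\<beta> - 2)" and "2 \<le> \<beta>" and "0 < R" and "R \<le> r" and "0 \<le> c"
  shows "K * r\<^sup>2 \<le> c * r powr (\<beta>::real)"
proof -
  have "R powr (\<beta> - 2) \<le> r powr (\<beta> - 2)"
    using assms by (intro powr_mono2) auto
  then have "K \<le> c * r powr (\<beta> - 2)"
    using assms(1) \<open>0 \<le> c\<close> by (meson mult_left_mono order_trans)
  then have "K * r\<^sup>2 \<le> c * r powr (\<beta> - 2) * r\<^sup>2"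
    by (rule mult_right_mono) simp
  also have "\<dots> = c * (r powr (\<beta> - 2) * r powr 2)"
    using assms by simp
  also have "\<dots> = c * r powr \<beta>"
    by (simp flip: powr_add)
  finally show ?thesis .
qed

text \<open>
  One unit of the coefficient \<open>K\<close> absorbs the quadratic growth of the shells; what remains decays
  geometrically in \<open>m\<close> because \<open>(R + m)\<^sup>2 \<ge> R\<^sup>2 + m\<close>.
\<close>

lemma shell_term_le:
  assumes "1 \<le> R" and "2 \<le> K"
  shows "(R + real m + 1)\<^sup>2 * exp (- (K * (R + real m)\<^sup>2)) \<le> 4 * exp (- ((K - 1) * R\<^sup>2)) * (1 / 2) ^ m"
proof -
  define r where "r = R + real m"
  have "(r + 1)\<^sup>2 \<le> (2 * r)\<^sup>2"
    using assms by (intro power_mono) (auto simp: r_def)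
  also have "\<dots> \<le> 4 * exp (r\<^sup>2)"
    using exp_ge_add_one_self[of "r\<^sup>2"] by (simp add: power_mult_distrib del: exp_ge_add_one_self)
  finally have "(r + 1)\<^sup>2 * exp (- (K * r\<^sup>2)) \<le> 4 * exp (r\<^sup>2) * exp (- (K * r\<^sup>2))"
    by (rule mult_right_mono) simp
  also have "\<dots> = 4 * exp (- ((K - 1) * r\<^sup>2))"
    by (simp add: algebra_simps flip: exp_add)
  also have "exp (- ((K - 1) * r\<^sup>2)) \<le> exp (- ((K - 1) * R\<^sup>2) + - real m)"
  proof -
    have "real m \<le> 2 * R * real m"
      using assms by (simp add: mult_le_cancel_right1)
    then have "R\<^sup>2 + real m \<le> r\<^sup>2"
      using zero_le_power2[of "real m"] unfolding r_def power2_sum by linarith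
    then have "(K - 1) * (R\<^sup>2 + real m) \<le> (K - 1) * r\<^sup>2"
      using assms by (intro mult_left_mono) auto
    moreover have "1 * real m \<le> (K - 1) * real m"
      using assms by (intro mult_right_mono) auto
    ultimately show ?thesis
      by (simp add: algebra_simps)
  qed
  also have "\<dots> = exp (- ((K - 1) * R\<^sup>2)) * exp (- 1) ^ m"
    by (simp add: exp_diff exp_minus power_inverse divide_inverse flip: exp_of_nat_mult)
  also have "exp (- 1) ^ m \<le> (1 / 2 :: real) ^ m"
  proof (intro power_mono)
    show "exp (- 1) \<le> (1 / 2 :: real)"
      using exp_ge_add_one_self[of 1] by (simp add: exp_minus field_simps)
  qed simp
  finally show ?thesis
    by (simp add: r_def mult_left_mono)
qed

lemma shell_sum_le:
  assumes "1 \<le> R" and "2 \<le> K" and "0 \<le> lam"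
    and h: "\<And>r. R \<le> r \<Longrightarrow> K * r\<^sup>2 \<le> h r"
  shows "ennreal (exp (- h R)) +
      (\<Sum>m. ennreal (lam * pi * (R + real m + 1)\<^sup>2 * exp (- h (R + real m))))
    \<le> ennreal ((1 + 8 * lam * pi) * exp (- ((K - 1) * R\<^sup>2)))"
proof -
  define x where "x = exp (- ((K - 1) * R\<^sup>2))"
  have "(\<Sum>m. ennreal (lam * pi * (R + real m + 1)\<^sup>2 * exp (- h (R + real m))))
      \<le> (\<Sum>m. ennreal (4 * lam * pi * x * (1 / 2) ^ m))"
  proof (intro suminf_le ennreal_leI)
    fix m
    have "(R + real m + 1)\<^sup>2 * exp (- h (R + real m)) \<le> (R + real m + 1)\<^sup>2 * exp (- (K * (R + real m)\<^sup>2))"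
      using h[of "R + real m"] by (intro mult_left_mono) auto
    also have "\<dots> \<le> 4 * x * (1 / 2) ^ m"
      using shell_term_le assms unfolding x_def by blast
    finally have "lam * pi * ((R + real m + 1)\<^sup>2 * exp (- h (R + real m))) \<le> lam * pi * (4 * x * (1 / 2) ^ m)"
      using \<open>0 \<le> lam\<close> by (intro mult_left_mono) auto
    then show "lam * pi * (R + real m + 1)\<^sup>2 * exp (- h (R + real m)) \<le> 4 * lam * pi * x * (1 / 2) ^ m"
      by (simp add: mult_ac)
  qed auto
  also have "\<dots> = ennreal (8 * lam * pi * x)"
  proof (rule suminf_ennreal_eq)
    show "(\<lambda>m. 4 * lam * pi * x * (1 / 2) ^ m) sums (8 * lam * pi * x)"
      using sums_mult[OF geometric_sums[of "1/2 :: real"], of "4 * lam * pi * x"] by (simp add: mult.assoc)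
  qed (use \<open>0 \<le> lam\<close> in \<open>simp add: x_def\<close>)
  finally have "ennreal (exp (- h R)) +
      (\<Sum>m. ennreal (lam * pi * (R + real m + 1)\<^sup>2 * exp (- h (R + real m)))) \<le> ennreal x + ennreal (8 * lam * pi * x)"
  proof (rule add_mono[rotated])
    have "(K - 1) * R\<^sup>2 \<le> h R"
      using h[of R] by (simp add: algebra_simps add_increasing2)
    then show "ennreal (exp (- h R)) \<le> ennreal x"
      by (simp add: x_def)
  qed
  also have "\<dots> = ennreal ((1 + 8 * lam * pi) * x)"
    using \<open>0 \<le> lam\<close> by (simp add: x_def algebra_simps flip: ennreal_plus)
  finally show ?thesis
    by (simp add: x_def)
qed

theorem proposition3p3:
  fixes P :: "real^2 \<Rightarrow> real^2 \<Rightarrow> 'w measure"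
    and N :: "'w \<Rightarrow> node network"
    and W :: "real measure"
    and lam p \<mu> w A \<beta> T :: real
  assumes "0 < lam" and "0 < p" and "p < 1" and "0 < T"
    and "0 < \<mu>"
    and "0 < w" and "AE v in W. v > w"
    and "0 < A" and "2 < \<beta>"
    and "\<And>X Y. X \<noteq> Y \<Longrightarrow>
           two_point_palm (P X Y) N lam p W (density lborel (exponential_density \<mu>)) X Y"
  shows "((\<lambda>(X, Y).
            (\<integral>\<^sup>+ \<omega>. ennreal_of_enat
                (delay (\<lambda>r. (A * r) powr \<beta>) T (N \<omega>) Source Destination 0) \<partial>P X Y)
            / ennreal (norm (X - Y)))
          \<longlongrightarrow> \<infinity>) (filtercomap (\<lambda>(X, Y). norm (X - Y)) at_top)"
proof -
  define c where "c = \<mu> * (T * w) * A powr \<beta>"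
  \<comment> \<open>Chosen so that the lower bound \<open>q\<^sup>2 / (4 * \<epsilon>)\<close> becomes \<open>exp (R\<^sup>2) / (4 * C)\<close>.\<close>
  define K where "K = 2 * (lam * pi) + 2"
  define C where "C = 1 + 8 * lam * pi"
  have "0 < c" "2 \<le> K" "0 < C"
    using assms by (auto simp: c_def K_def C_def intro!: add_pos_nonneg)
  define l where "l = (\<lambda>r. (A * r) powr \<beta>)"
  have l: "\<mu> * (T * w) * l r = c * r powr \<beta>" if "0 \<le> r" for r
    using \<open>0 < A\<close> that by (simp add: l_def c_def powr_mult)
  have delay_ge: "ennreal (norm (X - Y) / (4 * C)) \<le>
      (\<integral>\<^sup>+ \<omega>. ennreal_of_enat (delay l T (N \<omega>) Source Destination 0) \<partial>P X Y) / ennreal (norm (X - Y))"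
    if "1 \<le> norm (X - Y)" and K: "K \<le> c * norm (X - Y) powr (\<beta> - 2)" for X Y
  proof -
    define R where "R = norm (X - Y)"
    have "1 \<le> R" "X \<noteq> Y" and dist: "dist X Y = R"
      using that by (auto simp: R_def dist_norm)
    interpret two_point_palm "P X Y" N lam p W "density lborel (exponential_density \<mu>)" X Y
      using assms(10) \<open>X \<noteq> Y\<close> .
    define \<epsilon> where "\<epsilon> = C * exp (- ((K - 1) * R\<^sup>2))"
    have square: "K * r\<^sup>2 \<le> \<mu> * (T * w) * l r" if "R \<le> r" for r
    proof -
      have "K * r\<^sup>2 \<le> c * r powr \<beta>"
        by (rule powr_ge_square[of K c R])
          (use K that \<open>1 \<le> R\<close> \<open>2 < \<beta>\<close> \<open>0 < c\<close> in \<open>simp_all add: R_def[symmetric]\<close>)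
      then show ?thesis
        using l[of r] that \<open>1 \<le> R\<close> by simp
    qed
    have "ennreal ((exp (- (lam * pi * R\<^sup>2)))\<^sup>2 / (4 * \<epsilon>)) \<le>
      (\<integral>\<^sup>+ \<omega>. ennreal_of_enat (delay l T (N \<omega>) Source Destination 0) \<partial>P X Y)"
      unfolding dist[symmetric]
    proof (rule nn_integral_delay_ge)
      show "mono_on {0..} l"
        using \<open>0 < A\<close> \<open>2 < \<beta>\<close> by (auto simp: l_def intro!: mono_onI powr_mono2 mult_left_mono)
      show "ennreal (exp (- (\<mu> * (T * w) * l (dist X Y)))) +
          (\<Sum>m. ennreal (lam * pi * (dist X Y + real m + 1)\<^sup>2 * exp (- (\<mu> * (T * w) * l (dist X Y + real m)))))
          \<le> ennreal \<epsilon>"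
        unfolding \<epsilon>_def C_def dist
        using \<open>1 \<le> R\<close> \<open>2 \<le> K\<close> \<open>0 < lam\<close> square by (intro shell_sum_le) auto
    qed (use assms \<open>X \<noteq> Y\<close> \<open>0 < C\<close> in \<open>auto simp: l_def \<epsilon>_def\<close>)
    moreover have "R\<^sup>2 / (4 * C) \<le> (exp (- (lam * pi * R\<^sup>2)))\<^sup>2 / (4 * \<epsilon>)"
    proof -
      have "(exp (- (lam * pi * R\<^sup>2)))\<^sup>2 / (4 * \<epsilon>) = exp (R\<^sup>2) / (4 * C)"
        by (simp add: \<epsilon>_def K_def exp_minus power2_eq_square field_simps flip: exp_add)
      moreover have "R\<^sup>2 \<le> exp (R\<^sup>2)"
        using exp_ge_add_one_self[of "R\<^sup>2"] by linarith
      ultimately show ?thesis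
        using \<open>0 < C\<close> by (simp add: divide_right_mono)
    qed
    ultimately have "ennreal (R\<^sup>2 / (4 * C)) \<le>
      (\<integral>\<^sup>+ \<omega>. ennreal_of_enat (delay l T (N \<omega>) Source Destination 0) \<partial>P X Y)"
      by (meson ennreal_leI order_trans)
    then have "ennreal (R\<^sup>2 / (4 * C)) / ennreal R \<le>
      (\<integral>\<^sup>+ \<omega>. ennreal_of_enat (delay l T (N \<omega>) Source Destination 0) \<partial>P X Y) / ennreal R"
      by (rule divide_right_mono_ennreal)
    then show ?thesis
      using \<open>1 \<le> R\<close> \<open>0 < C\<close> by (simp add: R_def[symmetric] divide_ennreal power2_eq_square)
  qed
  show ?thesis
    unfolding infinity_ennreal_def tendsto_top_iff_ennreal
  proof (intro allI impI)
    fix M :: real assume "0 \<le> M"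
    have "\<forall>\<^sub>F R in at_top. K / c \<le> R powr (\<beta> - 2)"
      using eventually_ge_at_top[of "(K / c) powr (1 / (\<beta> - 2))"]
    proof eventually_elim
      case (elim R)
      have "K / c = ((K / c) powr (1 / (\<beta> - 2))) powr (\<beta> - 2)"
        using \<open>2 < \<beta>\<close> \<open>2 \<le> K\<close> \<open>0 < c\<close> by (simp add: powr_powr)
      also have "\<dots> \<le> R powr (\<beta> - 2)"
        using elim \<open>2 < \<beta>\<close> by (intro powr_mono2) auto
      finally show ?case .
    qed
    then have "\<forall>\<^sub>F R in at_top. 1 \<le> R \<and> K \<le> c * R powr (\<beta> - 2) \<and> M < R / (4 * C)"
      using eventually_ge_at_top[of 1] eventually_gt_at_top[of "M * (4 * C)"]
      by eventually_elim (use \<open>0 < c\<close> \<open>0 < C\<close> in \<open>simp add: field_simps\<close>)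
    then have "\<forall>\<^sub>F Z in filtercomap (\<lambda>(X, Y). norm (X - Y)) at_top.
        1 \<le> norm (fst Z - snd Z) \<and> K \<le> c * norm (fst Z - snd Z) powr (\<beta> - 2) \<and> M < norm (fst Z - snd Z) / (4 * C)"
      by (auto simp: eventually_filtercomap case_prod_beta)
    then show "\<forall>\<^sub>F Z in filtercomap (\<lambda>(X, Y). norm (X - Y)) at_top. ennreal M < (case Z of (X, Y) \<Rightarrow>
        (\<integral>\<^sup>+ \<omega>. ennreal_of_enat (delay (\<lambda>r. (A * r) powr \<beta>) T (N \<omega>) Source Destination 0) \<partial>P X Y)
        / ennreal (norm (X - Y)))"
    proof eventually_elim
      case (elim Z)
      have "ennreal M < ennreal (norm (fst Z - snd Z) / (4 * C))"
        using elim \<open>0 \<le> M\<close> by (simp add: ennreal_less_iff)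
      also have "\<dots> \<le> (\<integral>\<^sup>+ \<omega>. ennreal_of_enat (delay l T (N \<omega>) Source Destination 0) \<partial>P (fst Z) (snd Z))
          / ennreal (norm (fst Z - snd Z))"
        using elim by (intro delay_ge) auto
      finally show ?case
        by (simp add: l_def case_prod_beta)
    qed
  qed
qed

end
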